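(* Let $0<\alpha<2-\sqrt2$. Let $\{\xi_k,\ -\infty<k<\infty\}$ be independent standard normal random variables, let $\{\psi_k,\ k\ge 0\}$ be real weights with $\psi_k\sim k^{-(1+\alpha)/2}$ as $k\to\infty$, and put $$\eta_j=\sum_{k=0}^\infty\psi_k\xi_{j-k},\qquad \sigma^2={\rm E}(\eta_0^2)=\sum_{k=0}^\infty\psi_k^2,\qquad \tilde\eta_j=\eta_j/\sigma,\qquad j=0,1,2,\ldots .$$ Let $G:\mathbb R\to\mathbb R$ be Borel measurable with $J_1:={\rm E}(G(\tilde\eta_0)\tilde\eta_0)\neq 0$, let $Y_j=G(\tilde\eta_j)$, and assume $\mu:={\rm E}Y_0>0$ and ${\rm E}(Y_0^2)<\infty$. Let the sequence $\{Y_j\}$ be defined on an appropriate probability space together with a fractional Brownian motion $\{W_{1-\alpha/2}(t),\ t\ge0\}$ such that, for every $\delta>0$, as $T\to\infty$, $$\sup_{0\le t\le T}\left|S(t)-\mu t-\frac{J_1\kappa_\alpha}{\sigma}W_{1-\alpha/2}(t)\right|=o_{\rm a.s.}(T^{\gamma/2+\delta}),$$ $$\sup_{0\le t\le T}\left|\mu N(\mu t)-\mu t+\frac{J_1\kappa_\alpha}{\sigma}W_{1-\alpha/2}(t)\right|=o_{\rm a.s.}(T^{\gamma/2+\delta}+T^{(1-\alpha/2)^2+\delta})$$ (such a probability space and process are known to exist). Then, for every $\delta>0$, as $T\to\infty$, $$Q(T)=\frac{J_1\kappa_\alpha}{\sigma}\left(W_{1-\alpha/2}(T)-W_{1-\alpha/2}(N(\mu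 T))\right)+o_{\rm a.s.}(T^{\gamma/2+\delta})$$ $$=\frac{J_1\kappa_\alpha}{\sigma}\left(W_{1-\alpha/2}(T)-W_{1-\alpha/2}\left(T-\frac{J_1\kappa_\alpha}{\sigma\mu}W_{1-\alpha/2}(T)\right)\right)+o_{\rm a.s.}(T^{\gamma/2+\delta}).$$
   Context: For $t\ge 0$ (with $[t]$ the integer part of $t$) define $$S(t)=\sum_{i=1}^{[t]}Y_i,\qquad N(t)=\inf\{s\ge 1:\ S(s)>t\},\qquad Q(t)=S(t)+\mu N(\mu t)-2\mu t .$$ For $1/2<H<1$, a fractional Brownian motion $\{W_H(t),\,t\ge0\}$ is a mean-zero Gaussian process with covariance ${\rm E}W_H(s)W_H(t)=\frac12(s^{2H}+t^{2H}-|s-t|^{2H})$ (taken with continuous paths). The constant $\kappa_\alpha>0$ is given by $$\kappa_\alpha^2=2\,\frac{\int_0^\infty x^{-(\alpha+1)/2}(1+x)^{-(\alpha+1)/2}\,dx}{(1-\alpha)(2-\alpha)},$$ and $\gamma=2-2\alpha$ if $\alpha<1/2$, $\gamma=1$ if $\alpha\ge1/2$. Convention: $W_{1-\alpha/2}(T-u)=0$ if $u>T$. $o_{\rm a.s.}(\cdot)$ means that the $o$ relation holds almost surely as $T\to\infty$. Known background: let $0<\alpha<1$, let $\{\xi_k,\ -\infty<k<\infty\}$ be independent standard normal random variables, let $\psi_k\sim k^{-(1+\alpha)/2}$ as $k\to\infty$, let $\eta_j=\sum_{k=0}^\infty\psi_k\xi_{j-k}$, $\sigma^2={\rm E}(\eta_0^2)$,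 $\tilde\eta_j=\eta_j/\sigma$, let $G$ be a real-valued Borel measurable function with $J_1={\rm E}(G(\tilde\eta_0)\tilde\eta_0)\neq0$, and let $Y_j=G(\tilde\eta_j)$ with $\mu={\rm E}Y_0>0$ and ${\rm E}(Y_0^2)<\infty$. Then on an appropriate probability space for $\{Y_j\}$ one can construct a fractional Brownian motion $W_{1-\alpha/2}$ such that, for every $\delta>0$, as $T\to\infty$, $\sup_{0\le t\le T}\left|S(t)-\mu t-\frac{J_1\kappa_\alpha}{\sigma}W_{1-\alpha/2}(t)\right|=o_{\rm a.s.}(T^{\gamma/2+\delta})$ and $\sup_{0\le t\le T}\left|\mu N(\mu t)-\mu t+\frac{J_1\kappa_\alpha}{\sigma}W_{1-\alpha/2}(t)\right|=o_{\rm a.s.}(T^{\gamma/2+\delta}+T^{(1-\alpha/2)^2+\delta})$; $W_{1-\alpha/2}$ in the claim is this process. *)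

theory Defs
  imports "HOL-Probability.Probability" "HOL-Library.Landau_Symbols"
begin

text \<open>Degenerate (constant) normal variables are included, as needed for example for
  fractional Brownian motion at time 0.\<close>

definition normal_rv :: "'a measure \<Rightarrow> ('a \<Rightarrow> real) \<Rightarrow> bool" where
  "normal_rv M X \<longleftrightarrow> X \<in> borel_measurable M \<and>
     ((\<exists>m s. s > 0 \<and> distributed M lborel X (normal_density m s)) \<or>
      (\<exists>m. AE \<omega> in M. X \<omega> = m))"

definition gaussian_process :: "'a measure \<Rightarrow> 't set \<Rightarrow> ('t \<Rightarrow> 'a \<Rightarrow> real) \<Rightarrow> bool" where
  "gaussian_process M I X \<longleftrightarrow>
     (\<forall>F c. finite F \<and> F \<subseteq> I \<longrightarrow> normal_rv M (\<lambda>\<omega>. \<Sum>t\<in>F. c t * X t \<omega>))"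

text \<open>Only the values of the process at times \<open>t \<ge> 0\<close> are constrained.\<close>

definition fractional_brownian_motion ::
    "'a measure \<Rightarrow> real \<Rightarrow> (real \<Rightarrow> 'a \<Rightarrow> real) \<Rightarrow> bool" where
  "fractional_brownian_motion M H W \<longleftrightarrow>
     1/2 < H \<and> H < 1 \<and>
     gaussian_process M {0..} W \<and>
     (\<forall>t\<ge>0. prob_space.expectation M (W t) = 0) \<and>
     (\<forall>s\<ge>0. \<forall>t\<ge>0. prob_space.expectation M (\<lambda>\<omega>. W s \<omega> * W t \<omega>)
        = (s powr (2*H) + t powr (2*H) - \<bar>s - t\<bar> powr (2*H)) / 2) \<and>
     (\<forall>\<omega>\<in>space M. continuous_on {0..} (\<lambda>t. W t \<omega>))"

text \<open>The convention that the process is 0 at negative times.\<close>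

definition zero_before :: "(real \<Rightarrow> 'a \<Rightarrow> real) \<Rightarrow> real \<Rightarrow> 'a \<Rightarrow> real" where
  "zero_before W t \<omega> = (if t < 0 then 0 else W t \<omega>)"

text \<open>The series converges almost surely when the weights are square summable and the
  innovations are independent standard normal; in general it converges only
  conditionally, hence the ordered sum \<open>suminf\<close>.\<close>

definition moving_average :: "(nat \<Rightarrow> real) \<Rightarrow> (int \<Rightarrow> 'a \<Rightarrow> real) \<Rightarrow> nat \<Rightarrow> 'a \<Rightarrow> real" where
  "moving_average \<psi> \<xi> j \<omega> = (\<Sum>k. \<psi> k * \<xi> (int j - int k) \<omega>)"

definition partial_sum :: "(nat \<Rightarrow> 'a \<Rightarrow> real) \<Rightarrow> real \<Rightarrow> 'a \<Rightarrow> real" where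
  "partial_sum Y t \<omega> = (\<Sum>i = 1..nat \<lfloor>t\<rfloor>. Y i \<omega>)"

text \<open>The infimum is over real \<open>s\<close>; as \<open>partial_sum\<close> is constant on each \<open>[n, n+1)\<close>, it agrees
  with the infimum over integers. The real \<open>Inf\<close> has no meaningful value on the empty set,
  but if the partial sums grow like \<open>\<mu> t\<close> with \<open>\<mu> > 0\<close> almost surely, then almost surely the
  set is nonempty for every \<open>t\<close>.\<close>

definition first_passage :: "(nat \<Rightarrow> 'a \<Rightarrow> real) \<Rightarrow> real \<Rightarrow> 'a \<Rightarrow> real" where
  "first_passage Y t \<omega> = Inf {s. s \<ge> 1 \<and> partial_sum Y s \<omega> > t}"

definition Qproc :: "real \<Rightarrow> (nat \<Rightarrow> 'a \<Rightarrow> real) \<Rightarrow> real \<Rightarrow> 'a \<Rightarrow> real" where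
  "Qproc \<mu> Y t \<omega> = partial_sum Y t \<omega> + \<mu> * first_passage Y (\<mu> * t) \<omega> - 2 * \<mu> * t"

definition kappa :: "real \<Rightarrow> real" where
  "kappa \<alpha> = sqrt (2 * (LBINT x:{0<..}. x powr (-(\<alpha>+1)/2) * (1+x) powr (-(\<alpha>+1)/2))
                     / ((1-\<alpha>) * (2-\<alpha>)))"

definition gamma_exp :: "real \<Rightarrow> real" where
  "gamma_exp \<alpha> = (if \<alpha> < 1/2 then 2 - 2*\<alpha> else 1)"

definition o_as :: "'a measure \<Rightarrow> (real \<Rightarrow> 'a \<Rightarrow> real) \<Rightarrow> (real \<Rightarrow> real) \<Rightarrow> bool" where
  "o_as M X g \<longleftrightarrow> (AE \<omega> in M. (\<lambda>T. X T \<omega>) \<in> o[at_top](g))"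

end

theory Submission
  imports Defs
begin

text \<open>
  Write \<open>w = (J\<^sub>1 \<kappa> / \<sigma>) W\<close>, \<open>H = 1 - \<alpha>/2\<close> and \<open>n = N (\<mu> T)\<close>. By the definition of first passage,
  \<open>S n\<close> exceeds \<open>\<mu> T\<close> by at most \<open>S n - S (n - 1)\<close>, which is \<open>\<mu>\<close> plus a unit increment of \<open>w\<close>
  plus an admissible error. Replacing \<open>S T\<close> and \<open>S n\<close> by their approximations therefore turns
  \<open>Q T\<close> into \<open>w T - w n\<close>. Next, \<open>n\<close> differs from \<open>T - w T / \<mu>\<close> by at most about
  \<open>T\<close> to the power \<open>max (\<gamma>/2) (H\<^sup>2)\<close>, and an increment of \<open>w\<close> over a time span \<open>L\<close> within \<open>[0, T]\<close>
  is at most of order \<open>L\<close> to the power \<open>H\<close> up to small powers of \<open>T\<close>; since \<open>H\<^sup>3 \<le> \<gamma>/2\<close>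
  the second form follows. The bound for increments is needed on the integers only, where it
  follows from Gaussian moments of high even order and a union bound.
\<close>

section \<open>Moments of Gaussian variables and the lattice modulus of fractional Brownian
  motion\<close>

text \<open>The sum of all \<open>X n\<close> has finite integral, hence is finite almost
  everywhere, and it dominates every term. This yields a random constant directly, in place of
  Markov's inequality with Borel-Cantelli.\<close>

lemma AE_bounded_of_summable_integrals:
  fixes X :: "nat \<Rightarrow> 'a \<Rightarrow> real"
  assumes int: "\<And>n. integrable M (X n)"
    and nonneg: "\<And>n \<omega>. 0 \<le> X n \<omega>"
    and sum: "summable (\<lambda>n. integral\<^sup>L M (X n))"
  shows "AE \<omega> in M. \<exists>C. \<forall>n. X n \<omega> \<le> C"
proof -
  have [measurable]: "X n \<in> borel_measurable M" for n
    using int[of n] by auto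
  have "(\<integral>\<^sup>+\<omega>. (\<Sum>n. ennreal (X n \<omega>)) \<partial>M) = (\<Sum>n. \<integral>\<^sup>+\<omega>. ennreal (X n \<omega>) \<partial>M)"
    by (rule nn_integral_suminf) simp
  also have "\<dots> = (\<Sum>n. ennreal (integral\<^sup>L M (X n)))"
    by (simp add: nn_integral_eq_integral int nonneg)
  also have "\<dots> = ennreal (\<Sum>n. integral\<^sup>L M (X n))"
    by (rule suminf_ennreal2) (use sum nonneg in auto)
  finally have "(\<integral>\<^sup>+\<omega>. (\<Sum>n. ennreal (X n \<omega>)) \<partial>M) \<noteq> \<infinity>" by simp
  then have "AE \<omega> in M. (\<Sum>n. ennreal (X n \<omega>)) \<noteq> \<infinity>"
    by (intro nn_integral_PInf_AE) auto
  then show ?thesis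
  proof eventually_elim
    case (elim \<omega>)
    have "X n \<omega> \<le> enn2real (\<Sum>n. ennreal (X n \<omega>))" for n
    proof -
      have "ennreal (X n \<omega>) \<le> (\<Sum>n. ennreal (X n \<omega>))"
        using sum_le_suminf[of "\<lambda>n. ennreal (X n \<omega>)" "{n}"] by simp
      then have "enn2real (ennreal (X n \<omega>)) \<le> enn2real (\<Sum>n. ennreal (X n \<omega>))"
        using elim by (intro enn2real_mono) (auto simp: less_top)
      then show ?thesis using nonneg by simp
    qed
    then show ?case by blast
  qed
qed

context prob_space
begin

text \<open>Supplies the integrability without which expectations of increments cannot be expanded
  by linearity. The degenerate case is almost surely constant; otherwise the central moments of the
  normal density are shifted back by the mean.\<close>

lemma normal_rv_integrable_square:
  assumes "normal_rv M X"
  shows "integrable M X" "integrable M (\<lambda>\<omega>. (X \<omega>)\<^sup>2)"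
proof -
  have [measurable]: "X \<in> borel_measurable M"
    using assms by (simp add: normal_rv_def)
  have "integrable M X \<and> integrable M (\<lambda>\<omega>. (X \<omega>)\<^sup>2)"
  proof (cases "\<exists>m s. s > 0 \<and> distributed M lborel X (normal_density m s)")
    case True
    then obtain m s where s: "s > 0" and D: "distributed M lborel X (normal_density m s)"
      by blast
    have "integrable M (\<lambda>\<omega>. (X \<omega> - m) ^ k)" for k
      using integrable_normal_moment[OF s, of m k]
        distributed_integrable[OF D, of "\<lambda>x. (x - m) ^ k"] by simp
    from this[of 1] this[of 2]
    have 1: "integrable M (\<lambda>\<omega>. X \<omega> - m)" and 2: "integrable M (\<lambda>\<omega>. (X \<omega> - m)\<^sup>2)"
      by simp_all
    have "integrable M (\<lambda>\<omega>. (X \<omega> - m) + m)"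
      using 1 by (rule Bochner_Integration.integrable_add) simp
    then have 3: "integrable M X" by simp
    have "integrable M (\<lambda>\<omega>. (X \<omega> - m)\<^sup>2 + (2 * m * X \<omega> - m\<^sup>2))"
      by (intro Bochner_Integration.integrable_add Bochner_Integration.integrable_diff 2
          integrable_mult_right 3) simp
    also have "(\<lambda>\<omega>. (X \<omega> - m)\<^sup>2 + (2 * m * X \<omega> - m\<^sup>2)) = (\<lambda>\<omega>. (X \<omega>)\<^sup>2)"
      by (simp add: fun_eq_iff power2_eq_square algebra_simps)
    finally show ?thesis using 3 by simp
  next
    case False
    then obtain m where m: "AE \<omega> in M. X \<omega> = m"
      using assms by (auto simp: normal_rv_def)
    have "integrable M X \<longleftrightarrow> integrable M (\<lambda>_. m)"
      by (rule integrable_cong_AE) (use m in auto)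
    moreover have "integrable M (\<lambda>\<omega>. (X \<omega>)\<^sup>2) \<longleftrightarrow> integrable M (\<lambda>_. m\<^sup>2)"
      by (rule integrable_cong_AE) (use m in auto)
    ultimately show ?thesis by simp
  qed
  then show "integrable M X" "integrable M (\<lambda>\<omega>. (X \<omega>)\<^sup>2)" by auto
qed

text \<open>Positive variance rules out the degenerate case, so \<open>X / s\<close> is standard
  normal and the value is the double factorial of 2k - 1. It does not depend on
  \<open>s\<close>.\<close>

lemma centered_normal_rv_even_moment:
  assumes X: "normal_rv M X" and mean: "expectation X = 0"
    and var: "expectation (\<lambda>\<omega>. (X \<omega>)\<^sup>2) = s\<^sup>2" and s: "s > 0"
  shows "has_bochner_integral M (\<lambda>\<omega>. (X \<omega> / s) ^ (2 * k)) (fact (2 * k) / (2 ^ k * fact k))"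
proof -
  have "distributed M lborel X (normal_density 0 s)"
  proof (cases "\<exists>m s. s > 0 \<and> distributed M lborel X (normal_density m s)")
    case True
    then obtain m t where t: "t > 0" and D: "distributed M lborel X (normal_density m t)"
      by blast
    have m: "m = 0"
      using normal_distributed_expectation[OF t D] mean by simp
    have "t\<^sup>2 = s\<^sup>2"
      using normal_distributed_variance[OF t D] var mean by simp
    then have "t = s" using t s by (simp add: power2_eq_iff)
    with D m show ?thesis by simp
  next
    case False
    then obtain m where m: "AE \<omega> in M. X \<omega> = m"
      using X by (auto simp: normal_rv_def)
    have [measurable]: "X \<in> borel_measurable M"
      using X by (simp add: normal_rv_def)
    have "expectation X = expectation (\<lambda>_. m)"
      by (rule integral_cong_AE) (use m in auto)
    then have "m = 0" using mean by (simp add: prob_space)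
    \<comment> \<open>A centered constant has variance 0, contradicting
      \<open>s > 0\<close>.\<close>
    then have "expectation (\<lambda>\<omega>. (X \<omega>)\<^sup>2) = expectation (\<lambda>_. 0)"
      by (intro integral_cong_AE) (use m in auto)
    then show ?thesis using var s by simp
  qed
  then have D: "distributed M lborel (\<lambda>\<omega>. X \<omega> / s) std_normal_density"
    using normal_standard_normal_convert[OF s, of X 0] by simp
  show ?thesis
    using distributed_integrable[OF D, of "\<lambda>x. x ^ (2 * k)"]
      distributed_integral[OF D, of "\<lambda>x. x ^ (2 * k)"] integrable_std_normal_moment[of "2 * k"]
      integral_std_normal_moment_even[of k]
    by (simp add: has_bochner_integral_iff)
qed

lemma fbm_increment:
  assumes W: "fractional_brownian_motion M H W" and u: "0 \<le> u" and uv: "u < v"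
  shows "normal_rv M (\<lambda>\<omega>. W v \<omega> - W u \<omega>)"
    and "expectation (\<lambda>\<omega>. W v \<omega> - W u \<omega>) = 0"
    and "expectation (\<lambda>\<omega>. (W v \<omega> - W u \<omega>)\<^sup>2) = ((v - u) powr H)\<^sup>2"
proof -
  have gp: "gaussian_process M {0..} W"
    and mean: "\<And>t. t \<ge> 0 \<Longrightarrow> expectation (W t) = 0"
    and cov: "\<And>s t. s \<ge> 0 \<Longrightarrow> t \<ge> 0 \<Longrightarrow> expectation (\<lambda>\<omega>. W s \<omega> * W t \<omega>)
        = (s powr (2*H) + t powr (2*H) - \<bar>s - t\<bar> powr (2*H)) / 2"
    using W by (auto simp: fractional_brownian_motion_def)
  \<comment> \<open>As \<open>u < v\<close>, the two times are distinct and their coefficients can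
    be chosen freely.\<close>
  have comb: "normal_rv M (\<lambda>\<omega>. a * W u \<omega> + b * W v \<omega>)" for a b
    using gp[unfolded gaussian_process_def, rule_format, of "{u, v}" "\<lambda>t. if t = u then a else b"]
      u uv by simp
  show "normal_rv M (\<lambda>\<omega>. W v \<omega> - W u \<omega>)"
    using comb[of "-1" 1] by simp
  have Wu: "integrable M (W u)" "integrable M (\<lambda>\<omega>. (W u \<omega>)\<^sup>2)"
    using normal_rv_integrable_square[OF comb[of 1 0]] by simp_all
  have Wv: "integrable M (W v)" "integrable M (\<lambda>\<omega>. (W v \<omega>)\<^sup>2)"
    using normal_rv_integrable_square[OF comb[of 0 1]] by simp_all
  \<comment> \<open>Polarization: the product is integrable because the squares of
    \<open>W u\<close>, \<open>W v\<close> and their sum are.\<close>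
  have "integrable M (\<lambda>\<omega>. (W u \<omega> + W v \<omega>)\<^sup>2)"
    using normal_rv_integrable_square[OF comb[of 1 1]] by simp
  then have "integrable M (\<lambda>\<omega>. ((W u \<omega> + W v \<omega>)\<^sup>2 - (W u \<omega>)\<^sup>2 - (W v \<omega>)\<^sup>2) / 2)"
    using Wu Wv by simp
  also have "(\<lambda>\<omega>. ((W u \<omega> + W v \<omega>)\<^sup>2 - (W u \<omega>)\<^sup>2 - (W v \<omega>)\<^sup>2) / 2) = (\<lambda>\<omega>. W u \<omega> * W v \<omega>)"
    by (simp add: fun_eq_iff power2_eq_square algebra_simps)
  finally have Wuv: "integrable M (\<lambda>\<omega>. W u \<omega> * W v \<omega>)" .
  show "expectation (\<lambda>\<omega>. W v \<omega> - W u \<omega>) = 0"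
    using Wu Wv mean u uv by simp
  have "expectation (\<lambda>\<omega>. (W v \<omega> - W u \<omega>)\<^sup>2)
      = expectation (\<lambda>\<omega>. (W v \<omega>)\<^sup>2 + (W u \<omega>)\<^sup>2 - 2 * (W u \<omega> * W v \<omega>))"
    by (rule Bochner_Integration.integral_cong) (auto simp: power2_eq_square algebra_simps)
  also have "\<dots> = expectation (\<lambda>\<omega>. W v \<omega> * W v \<omega>) + expectation (\<lambda>\<omega>. W u \<omega> * W u \<omega>)
      - 2 * expectation (\<lambda>\<omega>. W u \<omega> * W v \<omega>)"
    using Wu Wv Wuv by (simp add: power2_eq_square)
  also have "\<dots> = (v - u) powr (2 * H)"
    using u uv by (simp add: cov field_simps)
  also have "\<dots> = ((v - u) powr H)\<^sup>2"
    using uv by (simp add: power2_eq_square powr_add[symmetric])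
  finally show "expectation (\<lambda>\<omega>. (W v \<omega> - W u \<omega>)\<^sup>2) = ((v - u) powr H)\<^sup>2" .
qed

text \<open>All normalized increments have the same moment of order 2k. For given \<open>n\<close>
  there are \<open>n\<close> of them, and for large \<open>k\<close> the weight
  \<open>n powr (-2k\<epsilon>)\<close> outweighs this count and leaves a summable sequence.\<close>

lemma fbm_lattice_modulus:
  assumes W: "fractional_brownian_motion M H W" and \<epsilon>: "\<epsilon> > 0"
  shows "AE \<omega> in M. \<exists>C. \<forall>n::nat. \<forall>m<n.
    \<bar>W (real n) \<omega> - W (real m) \<omega>\<bar> \<le> C * real n powr \<epsilon> * (real n - real m) powr H"
proof -
  \<comment> \<open>With 2k\<epsilon> > 3 the expectation of \<open>X n\<close> below is of order
    \<open>n powr (1 - 2k\<epsilon>)\<close>, at most \<open>n powr (-2)\<close>.\<close>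
  obtain k :: nat where k: "3 / (2 * \<epsilon>) < real k"
    using reals_Archimedean2 by blast
  then have k3: "2 * real k * \<epsilon> > 3" and k0: "k > 0"
    using \<epsilon> by (auto simp: field_simps intro!: gr0I)
  define K :: real where "K = fact (2 * k) / (2 ^ k * fact k)"
  have K0: "K > 0" by (simp add: K_def)
  define Z where "Z n m \<omega> = (W (real n) \<omega> - W (real m) \<omega>) / (real n - real m) powr H"
    for n m :: nat and \<omega>
  have Z: "has_bochner_integral M (\<lambda>\<omega>. Z n m \<omega> ^ (2 * k)) K" if "m < n" for n m
    unfolding Z_def K_def using that fbm_increment[OF W, of "real m" "real n"]
    by (intro centered_normal_rv_even_moment) auto
  \<comment> \<open>Summing over \<open>m\<close> plays the role of a union bound:
    \<open>X n\<close> dominates the contribution of each single increment ending at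
    \<open>n\<close>.\<close>
  define X where "X n \<omega> = real n powr (- 2 * real k * \<epsilon>) * (\<Sum>m<n. Z n m \<omega> ^ (2 * k))" for n \<omega>
  have X: "has_bochner_integral M (X n) (real n powr (- 2 * real k * \<epsilon>) * (\<Sum>m<n. K))" for n
    unfolding X_def by (intro has_bochner_integral_mult_right has_bochner_integral_sum Z) simp
  have "AE \<omega> in M. \<exists>C. \<forall>n. X n \<omega> \<le> C"
  proof (rule AE_bounded_of_summable_integrals)
    show "integrable M (X n)" for n
      using X[of n] by (simp add: has_bochner_integral_iff)
    show "0 \<le> X n \<omega>" for n \<omega>
      unfolding X_def by (intro mult_nonneg_nonneg sum_nonneg) (auto simp: power_mult)
    have le: "expectation (X n) \<le> K * real n powr (-2)" for n
    \<comment> \<open>At \<open>n = 0\<close> both sides vanish, since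
      \<open>0 powr a = 0\<close>.\<close>
    proof (cases "n = 0")
      case False
      have "expectation (X n) = K * (real n powr (- 2 * real k * \<epsilon>) * real n powr 1)"
        using X[of n] False by (simp add: has_bochner_integral_iff)
      also have "\<dots> = K * real n powr (- 2 * real k * \<epsilon> + 1)"
        by (simp only: powr_add)
      also have "\<dots> \<le> K * real n powr (-2)"
        using K0 k3 False by (intro mult_left_mono powr_mono) auto
      finally show ?thesis .
    qed (use X[of 0] in \<open>simp add: has_bochner_integral_iff\<close>)
    have "summable (\<lambda>n. K * real n powr (-2))"
      by (intro summable_mult) (simp add: summable_real_powr_iff)
    then show "summable (\<lambda>n. expectation (X n))"
    proof (rule summable_comparison_test'[of _ 0])
      have "0 \<le> expectation (X n)" for n
        using X[of n] K0 by (simp add: has_bochner_integral_iff)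
      then show "norm (expectation (X n)) \<le> K * real n powr (-2)" for n
        using le[of n] by simp
    qed
  qed
  then show ?thesis
  proof eventually_elim
    case (elim \<omega>)
    then obtain C where C: "\<And>n. X n \<omega> \<le> C" by blast
    have "\<bar>W (real n) \<omega> - W (real m) \<omega>\<bar>
        \<le> max 1 C * real n powr \<epsilon> * (real n - real m) powr H" if mn: "m < n" for n m
    proof -
      have n: "real n > 0" using mn by simp
      have "real n powr (- 2 * real k * \<epsilon>) = inverse ((real n powr \<epsilon>) ^ (2 * k))"
        using n by (simp add: powr_minus powr_power mult.commute)
      then have "(\<bar>Z n m \<omega>\<bar> / real n powr \<epsilon>) ^ (2 * k)
          = real n powr (- 2 * real k * \<epsilon>) * Z n m \<omega> ^ (2 * k)"
        by (simp only: power_divide power_even_abs even_mult_iff even_numeral simp_thms)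
          (simp add: divide_inverse)
      also have "\<dots> \<le> X n \<omega>"
        unfolding X_def using mn
        by (intro mult_left_mono member_le_sum) (auto simp: power_mult)
      also have "\<dots> \<le> max 1 C" using C[of n] by simp
      \<comment> \<open>A constant at least 1 is below its own power, so the root of order 2k can be
        taken without changing the constant.\<close>
      also have "\<dots> \<le> max 1 C ^ (2 * k)"
        using k0 by (intro self_le_power) auto
      finally have "\<bar>Z n m \<omega>\<bar> / real n powr \<epsilon> \<le> max 1 C"
        using k0 by (subst (asm) power_mono_iff) auto
      then show ?thesis
        using mn n by (simp add: Z_def abs_divide field_simps)
    qed
    then show ?case by blast
  qed
qed

end

section \<open>Landau estimates for suprema and powers\<close>

text \<open>Boundedness is essential: the real \<open>SUP\<close> of an unbounded set says nothing
  about its elements.\<close>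

lemma eventually_le_of_SUP_smallo:
  fixes f g :: "real \<Rightarrow> real"
  assumes "(\<lambda>T. SUP t\<in>{0..T}. f t) \<in> o[at_top](g)"
    and "\<And>T. bdd_above (f ` {0..T})" and "\<And>T. 0 \<le> g T"
  shows "\<forall>\<^sub>F T in at_top. \<forall>t\<in>{0..T}. f t \<le> g T"
proof -
  have "\<forall>\<^sub>F T in at_top. norm (SUP t\<in>{0..T}. f t) \<le> 1 * norm (g T)"
    using assms(1) by (rule landau_o.smallD) simp
  then show ?thesis
  proof eventually_elim
    case (elim T)
    then have "(SUP t\<in>{0..T}. f t) \<le> g T" using assms(3)[of T] by simp
    then show ?case
      using cSUP_upper[OF _ assms(2)[of T]] by (meson order_trans)
  qed
qed

lemma smallo_powrI:
  fixes f :: "real \<Rightarrow> real"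
  assumes "\<forall>\<^sub>F T in at_top. \<bar>f T\<bar> \<le> K * T powr a" and "a < b"
  shows "f \<in> o[at_top](\<lambda>T. T powr b)"
proof -
  have "f \<in> O[at_top](\<lambda>T. T powr a)"
    using assms(1) by (intro bigoI[of _ K]) (auto elim!: eventually_mono)
  also have "(\<lambda>T::real. T powr a) \<in> o[at_top](\<lambda>T. T powr b)"
    by (subst powr_smallo_iff) (use assms(2) in \<open>auto intro: filterlim_ident\<close>)
  finally show ?thesis .
qed

lemma powr_le_self:
  fixes x a :: real
  assumes "1 \<le> x" "a \<le> 1"
  shows "x powr a \<le> x"
  using powr_mono[OF assms(2,1)] assms(1) by simp

lemma powr_le_mult:
  fixes a c :: real
  assumes "c > 0" "a < 1"
  shows "\<forall>\<^sub>F T in at_top. T powr a \<le> c * T"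
proof -
  have "(\<lambda>T::real. T powr a) \<in> o[at_top](\<lambda>T. T powr 1)"
    using assms by (subst powr_smallo_iff) (auto intro: filterlim_ident)
  from landau_o.smallD[OF this assms(1)] eventually_ge_at_top[of 0]
  show ?thesis by eventually_elim simp
qed

text \<open>Passage times up to level \<mu>T may exceed \<open>T\<close> but eventually stay below
  2T, so estimates are needed on [0, 2T].\<close>

lemma eventually_double:
  fixes P :: "real \<Rightarrow> bool"
  assumes "\<forall>\<^sub>F T in at_top. P T"
  shows "\<forall>\<^sub>F T in at_top. P (2 * T)"
proof -
  have "filterlim (\<lambda>T::real. 2 * T) at_top at_top"
    by (intro filterlim_tendsto_pos_mult_at_top[OF tendsto_const] filterlim_ident) simp
  then show ?thesis using assms by (simp add: filterlim_iff)
qed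

lemma double_powr_le:
  fixes T a :: real
  assumes "T \<ge> 0" "a \<le> 1"
  shows "(2 * T) powr a \<le> 2 * T powr a"
  using assms powr_le_self[of 2 a] by (simp add: powr_mult mult_right_mono)

section \<open>Partial sums and first passage times\<close>

lemma partial_sum_floor: "partial_sum Y t \<omega> = partial_sum Y (real (nat \<lfloor>t\<rfloor>)) \<omega>"
  by (simp add: partial_sum_def)

lemma bdd_above_partial_sum:
  "bdd_above ((\<lambda>t. \<bar>partial_sum Y t \<omega>\<bar>) ` {0..T})"
proof (rule bdd_aboveI2)
  fix t assume t: "t \<in> {0..T}"
  have "\<bar>partial_sum Y t \<omega>\<bar> \<le> (\<Sum>i = 1..nat \<lfloor>t\<rfloor>. \<bar>Y i \<omega>\<bar>)"
    unfolding partial_sum_def by (rule sum_abs)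
  also have "\<dots> \<le> (\<Sum>i = 1..nat \<lfloor>T\<rfloor>. \<bar>Y i \<omega>\<bar>)"
    using t by (intro sum_mono2) (auto intro!: nat_mono floor_mono)
  finally show "\<bar>partial_sum Y t \<omega>\<bar> \<le> (\<Sum>i = 1..nat \<lfloor>T\<rfloor>. \<bar>Y i \<omega>\<bar>)" .
qed

text \<open>Partial sums change only at integers, so the infimum is the least integer time above the
  level. Its predecessor has not passed the level, which controls the overshoot.\<close>

lemma first_passage_attained:
  assumes unbounded: "\<exists>s\<ge>1. partial_sum Y s \<omega> > t" and t: "t \<ge> 0"
  obtains n where "n \<ge> 1" "first_passage Y t \<omega> = real n"
    "partial_sum Y (real n) \<omega> > t" "partial_sum Y (real n - 1) \<omega> \<le> t"
proof -
  define P where "P m \<longleftrightarrow> m \<ge> 1 \<and> partial_sum Y (real m) \<omega> > t" for m :: nat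
  define n where "n = (LEAST m. P m)"
  have floorP: "P (nat \<lfloor>s\<rfloor>)" if "s \<ge> 1" "partial_sum Y s \<omega> > t" for s
    using that unfolding P_def by (subst partial_sum_floor[symmetric]) (simp add: le_nat_iff)
  have Pn: "P n"
    using unbounded floorP LeastI[of P] unfolding n_def by blast
  have least: "n \<le> m" if "P m" for m
    using that unfolding n_def by (rule Least_le)
  have "first_passage Y t \<omega> = real n"
    unfolding first_passage_def
  proof (rule cInf_eq_minimum)
    show "real n \<in> {s. s \<ge> 1 \<and> partial_sum Y s \<omega> > t}"
      using Pn by (simp add: P_def)
    fix s assume "s \<in> {s. s \<ge> 1 \<and> partial_sum Y s \<omega> > t}"
    then have "s \<ge> 1" "n \<le> nat \<lfloor>s\<rfloor>"
      using least[OF floorP] by auto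
    then show "real n \<le> s" by (simp add: le_nat_iff le_floor_iff)
  qed
  moreover have "partial_sum Y (real n - 1) \<omega> \<le> t"
  \<comment> \<open>The predecessor 0 lies outside the range of admissible times; there the sum is
    empty and \<open>t \<ge> 0\<close> settles the claim.\<close>
  proof (cases "n = 1")
    case True
    then show ?thesis using t by (simp add: partial_sum_def)
  next
    case False
    then have "n - 1 \<ge> 1" "\<not> P (n - 1)"
      using Pn least[of "n - 1"] by (auto simp: P_def)
    then show ?thesis by (simp add: P_def of_nat_diff)
  qed
  ultimately show thesis using that Pn by (auto simp: P_def)
qed

text \<open>A higher level leaves fewer admissible times, and the hypothesis keeps that smaller set
  nonempty.\<close>

lemma first_passage_mono:
  assumes "\<exists>s\<ge>1. partial_sum Y s \<omega> > t'" "t \<le> t'"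
  shows "first_passage Y t \<omega> \<le> first_passage Y t' \<omega>"
  unfolding first_passage_def using assms
  by (intro cInf_superset_mono) (auto intro: bdd_belowI[of _ 1])

lemma first_passage_ge_1:
  assumes "\<exists>s\<ge>1. partial_sum Y s \<omega> > t"
  shows "first_passage Y t \<omega> \<ge> 1"
  unfolding first_passage_def using assms by (intro cInf_greatest) auto

section \<open>One sample path: oscillation and growth\<close>

text \<open>A deterministic setting for one sample point: \<open>w\<close> is the scaled fractional
  Brownian path, \<open>g\<close> stands for \<gamma>/2, and \<open>C\<close> is the constant of the
  lattice modulus for that path. The bounds on \<epsilon> keep all error terms sublinear.\<close>

locale approximated_path =
  fixes S w :: "real \<Rightarrow> real" and \<mu> H g \<epsilon> C :: real
  assumes \<mu>: "\<mu> > 0" and H: "0 < H" "H + \<epsilon> < 1" and g: "0 < g" "g + \<epsilon> < 1" and \<epsilon>: "\<epsilon> > 0"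
    and step: "t \<ge> 0 \<Longrightarrow> S t = S (real (nat \<lfloor>t\<rfloor>))"
    and lattice: "m < n \<Longrightarrow>
      \<bar>w (real n) - w (real m)\<bar> \<le> C * real n powr \<epsilon> * (real n - real m) powr H"
    and approx: "\<forall>\<^sub>F T in at_top. \<forall>t\<in>{0..T}. \<bar>S t - \<mu> * t - w t\<bar> \<le> T powr (g + \<epsilon>)"
begin

text \<open>The term in \<open>C\<close> pays for a span doubled by rounding, the rest for moving
  two endpoints to integers.\<close>

definition K :: real where "K = 2 * \<bar>C\<bar> + 2 * \<mu> + 4"

lemma K_pos: "K > 0"
  using \<mu> by (simp add: K_def)

lemma lattice_le:
  assumes "real m \<le> T" "real n \<le> T" "\<bar>real n - real m\<bar> \<le> L"
  shows "\<bar>w (real n) - w (real m)\<bar> \<le> \<bar>C\<bar> * (T powr \<epsilon> * L powr H)"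
proof -
  have *: "\<bar>w (real n) - w (real m)\<bar> \<le> \<bar>C\<bar> * (T powr \<epsilon> * L powr H)"
    if "m < n" "real n \<le> T" "real n - real m \<le> L" for m n
  proof -
    have "\<bar>w (real n) - w (real m)\<bar> \<le> C * (real n powr \<epsilon> * (real n - real m) powr H)"
      using lattice[OF that(1)] by (simp add: mult.assoc)
    also have "\<dots> \<le> \<bar>C\<bar> * (real n powr \<epsilon> * (real n - real m) powr H)"
      by (intro mult_right_mono) auto
    also have "\<dots> \<le> \<bar>C\<bar> * (T powr \<epsilon> * L powr H)"
      using that H \<epsilon> by (intro mult_left_mono mult_mono powr_mono2) auto
    finally show ?thesis .
  qed
  consider "m < n" | "m = n" | "n < m" by linarith
  then show ?thesis
    by cases (use *[of m n] *[of n m] assms in \<open>auto simp: abs_minus_commute\<close>)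
qed

text \<open>Since \<open>S\<close> is constant on each \<open>[n, n + 1)\<close>, the approximation itself controls the oscillation
  of \<open>w\<close> between consecutive integers, so that no chaining below scale 1 is needed.\<close>

lemma modulus:
  "\<forall>\<^sub>F T in at_top. \<forall>u\<in>{0..T}. \<forall>v\<in>{0..T}. \<forall>L\<ge>1. \<bar>u - v\<bar> \<le> L \<longrightarrow>
     \<bar>w u - w v\<bar> \<le> K * (T powr \<epsilon> * L powr H + T powr (g + \<epsilon>))"
  using approx eventually_ge_at_top[of 1]
proof eventually_elim
  case (elim T)
  define E where "E = T powr (g + \<epsilon>)"
  have E1: "E \<ge> 1" unfolding E_def using elim g \<epsilon> by (intro ge_one_powr_ge_zero) auto
  \<comment> \<open>Between \<open>u\<close> and its integer part \<open>S\<close> is unchanged, the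
    drift moves by at most \<mu>, and the approximation is used twice.\<close>
  have near: "\<bar>w u - w (real (nat \<lfloor>u\<rfloor>))\<bar> \<le> \<mu> + 2 * E" if "u \<in> {0..T}" for u
  proof -
    let ?n = "real (nat \<lfloor>u\<rfloor>)"
    have n: "?n = of_int \<lfloor>u\<rfloor>" using that by simp
    have "0 \<le> u - ?n" "u - ?n \<le> 1" unfolding n by linarith+
    moreover have "?n \<in> {0..T}" using calculation that by auto
    moreover have "\<mu> * u - \<mu> * ?n = \<mu> * (u - ?n)" by (simp add: algebra_simps)
    moreover have "\<mu> * (u - ?n) \<le> \<mu>" "0 \<le> \<mu> * (u - ?n)"
      using calculation(1,2) \<mu> mult_left_mono[of "u - ?n" 1 \<mu>] by simp_all
    moreover have "\<bar>S u - \<mu> * u - w u\<bar> \<le> E" "\<bar>S ?n - \<mu> * ?n - w ?n\<bar> \<le> E"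
      unfolding E_def using elim(1) that \<open>?n \<in> {0..T}\<close> by blast+
    moreover have "S u = S ?n" using that by (intro step) simp
    ultimately show ?thesis by linarith
  qed
  show ?case
  proof (intro ballI allI impI)
    fix u v L :: real
    assume u: "u \<in> {0..T}" and v: "v \<in> {0..T}" and L: "1 \<le> L" "\<bar>u - v\<bar> \<le> L"
    \<comment> \<open>Rounding enlarges the distance by at most 1, and
      \<open>L + 1 \<le> 2 * L\<close> because \<open>L \<ge> 1\<close>.\<close>
    have "\<bar>w (real (nat \<lfloor>u\<rfloor>)) - w (real (nat \<lfloor>v\<rfloor>))\<bar> \<le> \<bar>C\<bar> * (T powr \<epsilon> * (2 * L) powr H)"
    proof (rule lattice_le)
      show "real (nat \<lfloor>v\<rfloor>) \<le> T" "real (nat \<lfloor>u\<rfloor>) \<le> T"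
        using u v by (auto intro: order_trans[OF of_int_floor_le])
      have n: "real (nat \<lfloor>u\<rfloor>) = of_int \<lfloor>u\<rfloor>" "real (nat \<lfloor>v\<rfloor>) = of_int \<lfloor>v\<rfloor>"
        using u v by auto
      show "\<bar>real (nat \<lfloor>u\<rfloor>) - real (nat \<lfloor>v\<rfloor>)\<bar> \<le> 2 * L"
        unfolding n using L by linarith
    qed
    also have "(2 * L) powr H = 2 powr H * L powr H" using L by (simp add: powr_mult)
    also have "\<bar>C\<bar> * (T powr \<epsilon> * (2 powr H * L powr H)) \<le> \<bar>C\<bar> * (T powr \<epsilon> * (2 * L powr H))"
      using powr_le_self[of 2 H] H \<epsilon> by (intro mult_left_mono mult_right_mono) auto
    also have "\<dots> = 2 * \<bar>C\<bar> * (T powr \<epsilon> * L powr H)" by simp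
    finally have "\<bar>w (real (nat \<lfloor>u\<rfloor>)) - w (real (nat \<lfloor>v\<rfloor>))\<bar>
        \<le> 2 * \<bar>C\<bar> * (T powr \<epsilon> * L powr H)" .
    moreover have "\<bar>x - y\<bar> \<le> A + 2 * B"
      if "\<bar>a - b\<bar> \<le> A" "\<bar>x - a\<bar> \<le> B" "\<bar>y - b\<bar> \<le> B" for x y a b A B :: real
      using that by linarith
    ultimately have "\<bar>w u - w v\<bar> \<le> 2 * \<bar>C\<bar> * (T powr \<epsilon> * L powr H) + 2 * (\<mu> + 2 * E)"
      using near[OF u] near[OF v] by blast
    also have "\<dots> \<le> 2 * \<bar>C\<bar> * (T powr \<epsilon> * L powr H) + (2 * \<mu> + 4) * E"
      using mult_left_mono[OF E1, of "2 * \<mu>"] \<mu> by (simp add: algebra_simps)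
    also have "\<dots> \<le> K * (T powr \<epsilon> * L powr H) + K * E"
      using \<mu> E1 unfolding K_def by (intro add_mono mult_right_mono) auto
    finally show "\<bar>w u - w v\<bar> \<le> K * (T powr \<epsilon> * L powr H + T powr (g + \<epsilon>))"
      by (simp add: E_def algebra_simps)
  qed
qed

text \<open>The modulus over the span [0, T] is sublinear, since both exponents are below 1.\<close>

lemma w_le:
  assumes c: "c > 0"
  shows "\<forall>\<^sub>F T in at_top. \<bar>w T\<bar> \<le> c * T"
proof -
  \<comment> \<open>Each of the two modulus terms gets a third of \<open>c * T\<close>; the last
    third absorbs \<open>w 0\<close>, which is not assumed to be 0.\<close>
  define d where "d = c / (3 * K)"
  have d: "d > 0" unfolding d_def using c K_pos by simp
  have "\<epsilon> + H < 1" using H by simp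
  from modulus powr_le_mult[OF d this] powr_le_mult[OF d g(2)]
    eventually_ge_at_top[of 1] eventually_ge_at_top[of "3 * \<bar>w 0\<bar> / c"]
  show ?thesis
  proof eventually_elim
    case (elim T)
    have "\<bar>w T - w 0\<bar> \<le> K * (T powr \<epsilon> * T powr H + T powr (g + \<epsilon>))"
      using elim by auto
    also have "\<dots> \<le> K * (d * T + d * T)"
      using elim K_pos by (intro mult_left_mono add_mono) (auto simp: powr_add)
    also have "\<dots> = 2 / 3 * c * T"
      using K_pos by (simp add: d_def field_simps)
    finally have "\<bar>w T - w 0\<bar> \<le> 2 / 3 * c * T" .
    moreover have "\<bar>w 0\<bar> \<le> 1 / 3 * c * T" using elim(5) c by (simp add: field_simps)
    ultimately show ?case by linarith
  qed
qed

text \<open>The drift wins: \<open>w T\<close> and the error each cost at most a quarter of \<mu>T,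
  so \<open>S T\<close> eventually exceeds \<mu>T/2. Every level is therefore passed.\<close>

lemma unbounded: "\<exists>s\<ge>1. S s > t"
proof -
  have pos: "\<mu> / 4 > 0" using \<mu> by simp
  have "\<forall>\<^sub>F T in at_top. T \<ge> 1 \<and> S T > t"
    using approx w_le[OF pos] powr_le_mult[OF pos g(2)]
      eventually_ge_at_top[of 1] eventually_gt_at_top[of "2 * t / \<mu>"]
  proof eventually_elim
    case (elim T)
    have "\<bar>S T - \<mu> * T - w T\<bar> \<le> T powr (g + \<epsilon>)" using elim by auto
    moreover have "2 * t < \<mu> * T" using elim \<mu> by (simp add: field_simps)
    moreover have "4 * \<bar>w T\<bar> \<le> \<mu> * T" "4 * T powr (g + \<epsilon>) \<le> \<mu> * T" using elim by simp_all
    ultimately have "S T > t" by linarith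
    then show ?case using elim(4) by simp
  qed
  then show ?thesis
    by (auto simp: eventually_at_top_linorder)
qed

end

section \<open>One sample path: the two expansions\<close>

text \<open>Here \<open>N T\<close> is the passage time of level \<mu>T, and \<open>p\<close> stands
  for \<open>H^2\<close>, so that \<open>H * p \<le> g\<close> is the condition on
  \<open>H^3\<close>.\<close>

locale approximated_passage = approximated_path +
  fixes N :: "real \<Rightarrow> real" and p :: real
  assumes p: "0 < p" "p + \<epsilon> < 1" "H * p \<le> g"
    and passage: "T \<ge> 0 \<Longrightarrow> \<exists>n::nat. n \<ge> 1 \<and> N T = real n \<and> S (real n) > \<mu> * T \<and> S (real n - 1) \<le> \<mu> * T"
    and passage_approx: "\<forall>\<^sub>F T in at_top. \<bar>\<mu> * N T - \<mu> * T + w T\<bar> \<le> T powr (g + \<epsilon>) + T powr (p + \<epsilon>)"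
begin

lemma N_le: "\<forall>\<^sub>F T in at_top. N T \<le> 2 * T"
proof -
  have "\<mu> / 4 > 0" using \<mu> by simp
  from passage_approx w_le[OF this] powr_le_mult[OF this g(2)] powr_le_mult[OF this p(2)]
    eventually_ge_at_top[of 0]
  show ?thesis
  proof eventually_elim
    case (elim T)
    then have "\<mu> * N T \<le> 2 * (\<mu> * T)"
      by linarith
    then have "\<mu> * N T \<le> \<mu> * (2 * T)" by simp
    then show ?case using \<mu> by simp
  qed
qed

lemma first_order:
  "\<forall>\<^sub>F T in at_top. \<bar>(S T + \<mu> * N T - 2 * \<mu> * T) - (w T - w (N T))\<bar>
     \<le> (7 + \<mu> + 4 * K) * T powr (g + \<epsilon>)"
  using approx eventually_double[OF approx] eventually_double[OF modulus] N_le
    eventually_ge_at_top[of 1]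
proof eventually_elim
  case (elim T)
  obtain n :: nat where n: "n \<ge> 1" "N T = real n" "S (real n) > \<mu> * T" "S (real n - 1) \<le> \<mu> * T"
    using passage[of T] elim by auto
  define E where "E = T powr (g + \<epsilon>)"
  have E1: "E \<ge> 1" unfolding E_def using elim g \<epsilon> by (intro ge_one_powr_ge_zero) auto
  have E2: "(2 * T) powr (g + \<epsilon>) \<le> 2 * E"
    unfolding E_def using elim g by (intro double_powr_le) auto
  have "(2 * T) powr \<epsilon> \<le> (2 * T) powr (g + \<epsilon>)"
    using elim g by (intro powr_mono) auto
  with E2 have E3: "(2 * T) powr \<epsilon> \<le> 2 * E" by simp
  have nT: "real n \<in> {0..2*T}" "real n - 1 \<in> {0..2*T}" using n elim by auto
  have "\<bar>S T - \<mu> * T - w T\<bar> \<le> E" unfolding E_def using elim by auto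
  moreover have "\<bar>S (real n) - \<mu> * real n - w (real n)\<bar> \<le> 2 * E"
    using elim(2)[rule_format, OF nT(1)] E2 by simp
  moreover have "\<bar>S (real n - 1) - \<mu> * (real n - 1) - w (real n - 1)\<bar> \<le> 2 * E"
    using elim(2)[rule_format, OF nT(2)] E2 by simp
  moreover have "\<bar>w (real n) - w (real n - 1)\<bar> \<le> 4 * K * E"
  proof -
    have "\<bar>w (real n) - w (real n - 1)\<bar>
        \<le> K * ((2 * T) powr \<epsilon> * 1 powr H + (2 * T) powr (g + \<epsilon>))"
      using elim(3)[rule_format, OF nT, of 1] by simp
    also have "\<dots> \<le> K * (4 * E)"
      using E2 E3 K_pos by (intro mult_left_mono) auto
    finally show ?thesis by simp
  qed
  moreover have "\<mu> \<le> \<mu> * E" using E1 \<mu> by simp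
  \<comment> \<open>Passing the level at \<open>n\<close> bounds \<mu>n + w(n) below by \<mu>T - 2E.
    Not having passed it at n - 1 bounds it above by \<mu>T + 2E + \<mu> + 4KE, with one unit
    increment of \<open>w\<close>.\<close>
  ultimately have "\<bar>(S T + \<mu> * real n - 2 * \<mu> * T) - (w T - w (real n))\<bar>
     \<le> E + 2 * E + (\<mu> * E + 4 * K * E + 4 * E)"
    using n(3,4) by (simp only: abs_le_iff right_diff_distrib) linarith
  then show ?case by (simp add: n(2) E_def algebra_simps)
qed

text \<open>The two time points differ by order \<open>T powr (max g p + \<epsilon>)\<close>;
  raising this to the power \<open>H\<close> gives at most \<open>T powr (g + \<epsilon>)\<close>.
  The factor \<open>T powr \<epsilon>\<close> of the modulus accounts for the second
  \<epsilon>.\<close>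

lemma second_order:
  "\<forall>\<^sub>F T in at_top. 0 \<le> T - w T / \<mu> \<and>
     \<bar>w (N T) - w (T - w T / \<mu>)\<bar> \<le> K * (2 * (1 + 2 / \<mu>) + 2) * T powr (g + 2 * \<epsilon>)"
  using eventually_double[OF modulus] N_le passage_approx w_le[OF \<mu>] eventually_ge_at_top[of 1]
proof eventually_elim
  case (elim T)
  have T: "T \<ge> 1" by fact
  let ?v = "T - w T / \<mu>"
  have "\<bar>w T / \<mu>\<bar> \<le> T" using elim \<mu> by (simp add: field_simps abs_divide)
  then have "w T / \<mu> \<le> T" "- (w T / \<mu>) \<le> T" by (simp_all only: abs_le_iff)
  then have v: "0 \<le> ?v" "?v \<in> {0..2*T}" by (simp_all only: atLeastAtMost_iff) linarith+
  obtain n :: nat where n: "N T = real n" using passage[of T] T by auto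
  have NT: "N T \<in> {0..2*T}" using elim n by auto
  define b where "b = max g p + \<epsilon>"
  \<comment> \<open>The summand 1 guarantees \<open>L \<ge> 1\<close>, as the modulus
    requires.\<close>
  define L where "L = (1 + 2 / \<mu>) * T powr b"
  have b: "b \<ge> 0" using g \<epsilon> by (simp add: b_def)
  then have Tb: "T powr b \<ge> 1" using T by (intro ge_one_powr_ge_zero) auto
  have c1: "1 + 2 / \<mu> \<ge> 1" using \<mu> by simp
  have L1: "L \<ge> 1" unfolding L_def using mult_mono[OF c1 Tb] c1 by simp
  have "T powr (g + \<epsilon>) \<le> T powr b" "T powr (p + \<epsilon>) \<le> T powr b"
    unfolding b_def using T by (auto intro!: powr_mono)
  with elim(3) have "\<bar>\<mu> * N T - \<mu> * T + w T\<bar> \<le> 2 * T powr b" by linarith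
  moreover have "\<mu> * N T - \<mu> * T + w T = \<mu> * (N T - ?v)" using \<mu> by (simp add: field_simps)
  ultimately have "\<bar>N T - ?v\<bar> \<le> 2 / \<mu> * T powr b"
    using \<mu> by (simp add: abs_mult field_simps)
  also have "\<dots> \<le> L" unfolding L_def by (simp add: algebra_simps)
  finally have dist: "\<bar>N T - ?v\<bar> \<le> L" .
  have "L powr H = (1 + 2 / \<mu>) powr H * T powr (b * H)"
    unfolding L_def using c1 T by (simp add: powr_mult powr_powr)
  also have "\<dots> \<le> (1 + 2 / \<mu>) * T powr (g + \<epsilon>)"
  proof (intro mult_mono powr_mono)
    show "(1 + 2 / \<mu>) powr H \<le> 1 + 2 / \<mu>"
      using c1 H \<epsilon> by (intro powr_le_self) auto
    have H1: "H \<le> 1" using H \<epsilon> by simp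
    have "max g p * H \<le> g"
      using p(3) mult_left_mono[OF H1, of g] g by (simp add: max_def mult.commute)
    moreover have "\<epsilon> * H \<le> \<epsilon>" using mult_left_mono[OF H1, of \<epsilon>] \<epsilon> by simp
    ultimately show "b * H \<le> g + \<epsilon>" by (simp add: b_def algebra_simps)
  qed (use T c1 in auto)
  finally have LH: "L powr H \<le> (1 + 2 / \<mu>) * T powr (g + \<epsilon>)" .
  have "\<bar>w (N T) - w ?v\<bar> \<le> K * ((2 * T) powr \<epsilon> * L powr H + (2 * T) powr (g + \<epsilon>))"
    using elim(1)[rule_format, OF NT v(2) L1 dist] .
  also have "\<dots> \<le> K * ((2 * T powr \<epsilon>) * ((1 + 2 / \<mu>) * T powr (g + \<epsilon>)) + 2 * T powr (g + 2 * \<epsilon>))"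
  proof (intro mult_left_mono add_mono mult_mono LH)
    show "(2 * T) powr \<epsilon> \<le> 2 * T powr \<epsilon>"
      using T H by (intro double_powr_le) auto
    have "(2 * T) powr (g + \<epsilon>) \<le> 2 * T powr (g + \<epsilon>)"
      using T g by (intro double_powr_le) auto
    also have "\<dots> \<le> 2 * T powr (g + 2 * \<epsilon>)"
      using T \<epsilon> by (intro mult_left_mono powr_mono) auto
    finally show "(2 * T) powr (g + \<epsilon>) \<le> 2 * T powr (g + 2 * \<epsilon>)" .
  qed (use K_pos in auto)
  also have "T powr (g + 2 * \<epsilon>) = T powr \<epsilon> * T powr (g + \<epsilon>)"
    by (simp add: powr_add[symmetric] algebra_simps)
  finally have "\<bar>w (N T) - w ?v\<bar> \<le> K * (2 * (1 + 2 / \<mu>) + 2) * (T powr \<epsilon> * T powr (g + \<epsilon>))"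
    by (simp add: algebra_simps)
  also have "T powr \<epsilon> * T powr (g + \<epsilon>) = T powr (g + 2 * \<epsilon>)"
    by (simp add: powr_add[symmetric] algebra_simps)
  finally show ?case using v by simp
qed

text \<open>The shifted time is eventually nonnegative, so the zero convention does not affect the
  limit, and the second form is the first plus the difference of the two values of
  \<open>w\<close>.\<close>

lemma both_orders:
  assumes "2 * \<epsilon> < \<delta>"
  shows "(\<lambda>T. (S T + \<mu> * N T - 2 * \<mu> * T) - (w T - w (N T))) \<in> o[at_top](\<lambda>T. T powr (g + \<delta>))"
    and "(\<lambda>T. (S T + \<mu> * N T - 2 * \<mu> * T) - (w T - (if T - w T / \<mu> < 0 then 0 else w (T - w T / \<mu>))))
      \<in> o[at_top](\<lambda>T. T powr (g + \<delta>))"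
proof -
  show 1: "(\<lambda>T. (S T + \<mu> * N T - 2 * \<mu> * T) - (w T - w (N T))) \<in> o[at_top](\<lambda>T. T powr (g + \<delta>))"
    using first_order by (rule smallo_powrI) (use assms \<epsilon> in simp)
  have "(\<lambda>T. (if T - w T / \<mu> < 0 then 0 else w (T - w T / \<mu>)) - w (N T)) \<in> o[at_top](\<lambda>T. T powr (g + \<delta>))"
    using second_order
    by (intro smallo_powrI[of _ "K * (2 * (1 + 2 / \<mu>) + 2)" "g + 2 * \<epsilon>"])
      (use assms in \<open>auto elim!: eventually_mono simp: abs_minus_commute\<close>)
  from sum_in_smallo(1)[OF 1 this]
  show "(\<lambda>T. (S T + \<mu> * N T - 2 * \<mu> * T) - (w T - (if T - w T / \<mu> < 0 then 0 else w (T - w T / \<mu>))))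
      \<in> o[at_top](\<lambda>T. T powr (g + \<delta>))"
    by (simp add: algebra_simps)
qed

end

section \<open>From supremum bounds to one path, and the exponents\<close>

text \<open>Continuity enters through boundedness of \<open>w\<close> on compact intervals, which
  makes the suprema genuine. The locales are entered in two stages, because passage times make sense
  only once \<open>S\<close> is known to be unbounded.\<close>

lemma approximated_path_expansion:
  fixes Y :: "nat \<Rightarrow> 'a \<Rightarrow> real" and \<omega> :: 'a and \<mu> :: real
  defines "S \<equiv> \<lambda>t. partial_sum Y t \<omega>" and "N \<equiv> \<lambda>t. first_passage Y (\<mu> * t) \<omega>"
  assumes \<mu>: "\<mu> > 0" and H: "0 < H" "H + \<epsilon> < 1" and g: "0 < g" "g + \<epsilon> < 1" and \<epsilon>: "\<epsilon> > 0"
    and p: "0 < p" "p + \<epsilon> < 1" "H * p \<le> g" and \<delta>: "2 * \<epsilon> < \<delta>"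
    and cont: "continuous_on {0..} w"
    and lattice: "\<And>n m. m < n \<Longrightarrow>
      \<bar>w (real n) - w (real m)\<bar> \<le> C * real n powr \<epsilon> * (real n - real m) powr H"
    and S: "(\<lambda>T. SUP t\<in>{0..T}. \<bar>S t - \<mu> * t - w t\<bar>) \<in> o[at_top](\<lambda>T. T powr (g + \<epsilon>))"
    and N: "(\<lambda>T. SUP t\<in>{0..T}. \<bar>\<mu> * N t - \<mu> * t + w t\<bar>)
      \<in> o[at_top](\<lambda>T. T powr (g + \<epsilon>) + T powr (p + \<epsilon>))"
  shows "(\<lambda>T. (S T + \<mu> * N T - 2 * \<mu> * T) - (w T - w (N T))) \<in> o[at_top](\<lambda>T. T powr (g + \<delta>))"
    and "(\<lambda>T. (S T + \<mu> * N T - 2 * \<mu> * T) - (w T - (if T - w T / \<mu> < 0 then 0 else w (T - w T / \<mu>))))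
      \<in> o[at_top](\<lambda>T. T powr (g + \<delta>))"
proof -
  have "\<exists>B. \<forall>t\<in>{0..T}. \<bar>w t\<bar> \<le> B" for T
    using compact_imp_bounded[OF compact_continuous_image[OF continuous_on_subset[OF cont] compact_Icc[of 0 T]]]
    by (auto simp: bounded_iff)
  then obtain B where B: "\<And>t T. t \<in> {0..T} \<Longrightarrow> \<bar>w t\<bar> \<le> B T" by metis
  have bddS: "bdd_above ((\<lambda>t. \<bar>S t - \<mu> * t - w t\<bar>) ` {0..T})" for T
  proof -
    obtain b where b: "\<And>t. t \<in> {0..T} \<Longrightarrow> \<bar>S t\<bar> \<le> b"
      using bdd_above_partial_sum[of Y \<omega> T] unfolding bdd_above_def S_def ball_simps by blast
    show ?thesis
    proof (rule bdd_aboveI2)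
      fix t assume t: "t \<in> {0..T}"
      then have "\<mu> * t \<le> \<mu> * T" "0 \<le> \<mu> * t" using \<mu> by auto
      with b[OF t] B[OF t] show "\<bar>S t - \<mu> * t - w t\<bar> \<le> b + \<mu> * T + B T" by linarith
    qed
  qed
  interpret approximated_path S w \<mu> H g \<epsilon> C
  proof
    show "S t = S (real (nat \<lfloor>t\<rfloor>))" for t
      unfolding S_def by (rule partial_sum_floor)
    show "\<forall>\<^sub>F T in at_top. \<forall>t\<in>{0..T}. \<bar>S t - \<mu> * t - w t\<bar> \<le> T powr (g + \<epsilon>)"
      by (rule eventually_le_of_SUP_smallo[OF S bddS]) simp
  qed (use \<mu> H g \<epsilon> lattice in auto)
  have large: "\<exists>s\<ge>1. partial_sum Y s \<omega> > t" for t
    using unbounded[of t] by (simp add: S_def)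
  \<comment> \<open>Monotonicity bounds \<open>N\<close> on [0, T] by its final value.\<close>
  have bddN: "bdd_above ((\<lambda>t. \<bar>\<mu> * N t - \<mu> * t + w t\<bar>) ` {0..T})" for T
  proof (rule bdd_aboveI2)
    fix t assume t: "t \<in> {0..T}"
    then have t': "\<mu> * t \<le> \<mu> * T" "0 \<le> \<mu> * t" using \<mu> by auto
    have "1 \<le> N t" "N t \<le> N T"
      unfolding N_def using t'(1) by (auto intro: first_passage_ge_1 first_passage_mono large)
    then have "0 \<le> \<mu> * N t" "\<mu> * N t \<le> \<mu> * N T" using \<mu> by auto
    with t' B[OF t] show "\<bar>\<mu> * N t - \<mu> * t + w t\<bar> \<le> \<mu> * N T + \<mu> * T + B T" by linarith
  qed
  interpret approximated_passage S w \<mu> H g \<epsilon> C N p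
  proof
    show "\<exists>n::nat. n \<ge> 1 \<and> N T = real n \<and> S (real n) > \<mu> * T \<and> S (real n - 1) \<le> \<mu> * T"
      if "T \<ge> 0" for T
      using first_passage_attained[OF large[of "\<mu> * T"]] that \<mu> unfolding S_def N_def
      by (metis mult_nonneg_nonneg less_imp_le)
    have "\<forall>\<^sub>F T in at_top. \<forall>t\<in>{0..T}. \<bar>\<mu> * N t - \<mu> * t + w t\<bar> \<le> T powr (g + \<epsilon>) + T powr (p + \<epsilon>)"
      by (rule eventually_le_of_SUP_smallo[OF N bddN]) simp
    then show "\<forall>\<^sub>F T in at_top. \<bar>\<mu> * N T - \<mu> * T + w T\<bar> \<le> T powr (g + \<epsilon>) + T powr (p + \<epsilon>)"
      using eventually_ge_at_top[of 0] by eventually_elim auto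
  qed (use p in auto)
  show "(\<lambda>T. (S T + \<mu> * N T - 2 * \<mu> * T) - (w T - w (N T))) \<in> o[at_top](\<lambda>T. T powr (g + \<delta>))"
    and "(\<lambda>T. (S T + \<mu> * N T - 2 * \<mu> * T) - (w T - (if T - w T / \<mu> < 0 then 0 else w (T - w T / \<mu>))))
      \<in> o[at_top](\<lambda>T. T powr (g + \<delta>))"
    using both_orders[OF \<delta>] by auto
qed

lemma gamma_exp_bounds:
  assumes "0 < \<alpha>" "\<alpha> < 2 - sqrt 2"
  shows "0 < gamma_exp \<alpha> / 2" "gamma_exp \<alpha> / 2 < 1"
    "(1 - \<alpha>/2) * (1 - \<alpha>/2)\<^sup>2 \<le> gamma_exp \<alpha> / 2"
proof -
  show "0 < gamma_exp \<alpha> / 2" "gamma_exp \<alpha> / 2 < 1"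
    using assms by (auto simp: gamma_exp_def)
  show "(1 - \<alpha>/2) * (1 - \<alpha>/2)\<^sup>2 \<le> gamma_exp \<alpha> / 2"
  proof (cases "\<alpha> < 1/2")
    case True
    \<comment> \<open>The right side is the expanded difference of the two sides of the claim; its
      second factor is positive as \<alpha> < 1/2.\<close>
    have "0 \<le> \<alpha> / 2 * (1 - 3 / 2 * \<alpha> + \<alpha>\<^sup>2 / 4)"
      using True assms by (intro mult_nonneg_nonneg) auto
    also have "\<dots> = (1 - \<alpha>) - (1 - \<alpha>/2) * (1 - \<alpha>/2)\<^sup>2"
      by (simp add: power2_eq_square field_simps)
    finally show ?thesis using True by (simp add: gamma_exp_def)
  next
    case False
    have "1 \<le> sqrt (2::real)" by simp
    then have "0 \<le> 1 - \<alpha>/2" "1 - \<alpha>/2 \<le> 3/4" using assms False by linarith+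
    \<comment> \<open>The cube of 3/4 is 27/64, below \<gamma>/2 = 1/2.\<close>
    then have "(1 - \<alpha>/2) * (1 - \<alpha>/2)\<^sup>2 \<le> 3/4 * (3/4)\<^sup>2"
      by (intro mult_mono power_mono) auto
    then show ?thesis using False by (simp add: gamma_exp_def power2_eq_square)
  qed
qed

section \<open>Almost sure form of the expansions\<close>

theorem theorem3p1:
  fixes M :: "'a measure" and \<alpha> \<sigma> \<mu> J1 :: real
    and \<xi> :: "int \<Rightarrow> 'a \<Rightarrow> real" and \<psi> :: "nat \<Rightarrow> real"
    and \<eta> \<eta>' Y :: "nat \<Rightarrow> 'a \<Rightarrow> real" and G :: "real \<Rightarrow> real"
    and W :: "real \<Rightarrow> 'a \<Rightarrow> real"
  assumes M: "prob_space M"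
    and \<alpha>: "0 < \<alpha>" "\<alpha> < 2 - sqrt 2"
    and \<xi>_indep: "prob_space.indep_vars M (\<lambda>_. borel) \<xi> UNIV"
    and \<xi>_normal: "\<And>k. distributed M lborel (\<xi> k) std_normal_density"
    and \<psi>: "\<psi> \<sim>[at_top] (\<lambda>k. real k powr (-(1+\<alpha>)/2))"
    and \<eta>: "\<eta> = moving_average \<psi> \<xi>"
    and \<sigma>: "\<sigma> = sqrt (prob_space.expectation M (\<lambda>\<omega>. (\<eta> 0 \<omega>)\<^sup>2))"
    and \<eta>': "\<eta>' = (\<lambda>j \<omega>. \<eta> j \<omega> / \<sigma>)"
    and G: "G \<in> borel_measurable borel"
    and J1: "J1 = prob_space.expectation M (\<lambda>\<omega>. G (\<eta>' 0 \<omega>) * \<eta>' 0 \<omega>)" "J1 \<noteq> 0"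
    and Y: "Y = (\<lambda>j \<omega>. G (\<eta>' j \<omega>))"
    and \<mu>: "\<mu> = prob_space.expectation M (Y 0)" "\<mu> > 0"
    and Y_sq: "integrable M (\<lambda>\<omega>. (Y 0 \<omega>)\<^sup>2)"
    and W: "fractional_brownian_motion M (1 - \<alpha>/2) W"
    and approx_S: "\<And>\<delta>. \<delta> > 0 \<Longrightarrow>
          o_as M (\<lambda>T \<omega>. SUP t\<in>{0..T}.
                    \<bar>partial_sum Y t \<omega> - \<mu> * t - J1 * kappa \<alpha> / \<sigma> * W t \<omega>\<bar>)
                 (\<lambda>T. T powr (gamma_exp \<alpha> / 2 + \<delta>))"
    and approx_N: "\<And>\<delta>. \<delta> > 0 \<Longrightarrow>
          o_as M (\<lambda>T \<omega>. SUP t\<in>{0..T}.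
                    \<bar>\<mu> * first_passage Y (\<mu> * t) \<omega> - \<mu> * t + J1 * kappa \<alpha> / \<sigma> * W t \<omega>\<bar>)
                 (\<lambda>T. T powr (gamma_exp \<alpha> / 2 + \<delta>) + T powr ((1 - \<alpha>/2)\<^sup>2 + \<delta>))"
  shows "\<forall>\<delta>>0.
          o_as M (\<lambda>T \<omega>. Qproc \<mu> Y T \<omega>
                    - J1 * kappa \<alpha> / \<sigma> * (W T \<omega> - W (first_passage Y (\<mu> * T) \<omega>) \<omega>))
                 (\<lambda>T. T powr (gamma_exp \<alpha> / 2 + \<delta>)) \<and>
          o_as M (\<lambda>T \<omega>. Qproc \<mu> Y T \<omega>
                    - J1 * kappa \<alpha> / \<sigma> *
                        (W T \<omega> - zero_before W (T - J1 * kappa \<alpha> / (\<sigma> * \<mu>) * W T \<omega>) \<omega>))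
                 (\<lambda>T. T powr (gamma_exp \<alpha> / 2 + \<delta>))"
proof (intro allI impI)
  fix \<delta> :: real assume \<delta>: "\<delta> > 0"
  interpret prob_space M by fact
  define H where "H = 1 - \<alpha>/2"
  define g where "g = gamma_exp \<alpha> / 2"
  define c where "c = J1 * kappa \<alpha> / \<sigma>"
  have H: "0 < H" "H < 1"
    using W by (auto simp: fractional_brownian_motion_def H_def)
  have H2: "0 < H\<^sup>2" "H\<^sup>2 < 1" using H by (auto simp: power_strict_mono power_less_one_iff)
  have g: "0 < g" "g < 1" "H * H\<^sup>2 \<le> g"
    using gamma_exp_bounds[OF \<alpha>] by (auto simp: g_def H_def)
  \<comment> \<open>A third of \<delta> leaves room for the loss of 2\<epsilon>; the halves keep
    \<open>H + \<epsilon>\<close>, \<open>g + \<epsilon>\<close> and \<open>H^2 + \<epsilon>\<close>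
    below 1.\<close>
  define \<epsilon> where "\<epsilon> = Min {\<delta> / 3, (1 - H) / 2, (1 - g) / 2, (1 - H\<^sup>2) / 2}"
  have \<epsilon>_pos: "0 < \<epsilon>"
    unfolding \<epsilon>_def using \<delta> H g H2 by (subst Min_gr_iff) auto
  have "\<epsilon> \<le> \<delta> / 3" "\<epsilon> \<le> (1 - H) / 2" "\<epsilon> \<le> (1 - g) / 2" "\<epsilon> \<le> (1 - H\<^sup>2) / 2"
    unfolding \<epsilon>_def by (rule Min_le; simp)+
  then have \<epsilon>_le: "2 * \<epsilon> < \<delta>" "H + \<epsilon> < 1" "g + \<epsilon> < 1" "H\<^sup>2 + \<epsilon> < 1"
    using \<delta> H g H2 by (simp_all add: field_simps)
  note \<epsilon> = \<epsilon>_pos \<epsilon>_le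
  have WH: "fractional_brownian_motion M H W" using W by (simp add: H_def)
  have cont: "continuous_on {0..} (\<lambda>t. c * W t \<omega>)" if "\<omega> \<in> space M" for \<omega>
    using WH that by (auto simp: fractional_brownian_motion_def intro: continuous_on_mult_left)
  have zero: "c * zero_before W (T - J1 * kappa \<alpha> / (\<sigma> * \<mu>) * W T \<omega>) \<omega>
      = (if T - c * W T \<omega> / \<mu> < 0 then 0 else c * W (T - c * W T \<omega> / \<mu>) \<omega>)" for T \<omega>
    by (simp add: zero_before_def c_def)
  have "AE \<omega> in M.
      (\<lambda>T. Qproc \<mu> Y T \<omega> - c * (W T \<omega> - W (first_passage Y (\<mu> * T) \<omega>) \<omega>))
        \<in> o[at_top](\<lambda>T. T powr (g + \<delta>)) \<and>
      (\<lambda>T. Qproc \<mu> Y T \<omega>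
          - c * (W T \<omega> - zero_before W (T - J1 * kappa \<alpha> / (\<sigma> * \<mu>) * W T \<omega>) \<omega>))
        \<in> o[at_top](\<lambda>T. T powr (g + \<delta>))"
    \<comment> \<open>One \<epsilon> serves the modulus and both approximations; on the intersection
      of these almost sure events the argument is deterministic.\<close>
    using fbm_lattice_modulus[OF WH \<epsilon>(1)]
      approx_S[OF \<epsilon>(1), unfolded o_as_def, folded c_def g_def]
      approx_N[OF \<epsilon>(1), unfolded o_as_def, folded c_def g_def H_def] AE_space
  proof eventually_elim
    case (elim \<omega>)
    then obtain C where C: "\<And>n m. m < n \<Longrightarrow>
      \<bar>W (real n) \<omega> - W (real m) \<omega>\<bar> \<le> C * real n powr \<epsilon> * (real n - real m) powr H"
      by blast
    have lattice: "\<bar>c * W (real n) \<omega> - c * W (real m) \<omega>\<bar>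
        \<le> (\<bar>c\<bar> * C) * real n powr \<epsilon> * (real n - real m) powr H" if "m < n" for n m
      using mult_left_mono[OF C[OF that], of "\<bar>c\<bar>"]
      by (simp add: abs_mult[symmetric] right_diff_distrib mult.assoc)
    have "\<mu> > 0" by fact
    note exp = approximated_path_expansion[of \<mu> H \<epsilon> g "H\<^sup>2" \<delta> "\<lambda>t. c * W t \<omega>" "\<bar>c\<bar> * C" Y \<omega>,
        OF this H(1) \<epsilon>(3) g(1) \<epsilon>(4) \<epsilon>(1) H2(1) \<epsilon>(5) g(3) \<epsilon>(2) cont[OF elim(4)] lattice elim(2,3)]
    show ?case
      using exp unfolding Qproc_def right_diff_distrib zero by simp
  qed
  then show "o_as M (\<lambda>T \<omega>. Qproc \<mu> Y T \<omega>
                    - J1 * kappa \<alpha> / \<sigma> * (W T \<omega> - W (first_passage Y (\<mu> * T) \<omega>) \<omega>))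
                 (\<lambda>T. T powr (gamma_exp \<alpha> / 2 + \<delta>)) \<and>
          o_as M (\<lambda>T \<omega>. Qproc \<mu> Y T \<omega>
                    - J1 * kappa \<alpha> / \<sigma> *
                        (W T \<omega> - zero_before W (T - J1 * kappa \<alpha> / (\<sigma> * \<mu>) * W T \<omega>) \<omega>))
                 (\<lambda>T. T powr (gamma_exp \<alpha> / 2 + \<delta>))"
    unfolding o_as_def c_def g_def by simp
qed

end
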